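(* Let each $h_i$ be convex and differentiable, and suppose the constraints of the energy sharing game are feasible (there is $(p,b)$ satisfying the constraints of all prosumers simultaneously). Consider the optimization problem $$\min_{p\in\mathbb R^n}\ \sum_{i\in\mathcal N}\left(h_i(p_i)+\frac{p_i^2}{2(a_i-\mathbf 1^{\rm T}a)}-\frac{D_i}{a_i-\mathbf 1^{\rm T}a}p_i\right)\quad\text{s.t.}\quad \sum_{i\in\mathcal N}p_i=\sum_{i\in\mathcal N}D_i,\quad \underline p_i\le p_i\le\overline p_i\ (i\in\mathcal N).$$ Let $p^*$ be an optimal solution and let $\mu_c^*$ be a Lagrange multiplier of the equality constraint, i.e. $\sum_i p_i^*=\sum_i D_i$ and, for every $i$, $$0\in h_i'(p_i^* )+\frac{p_i^*}{a_i-\mathbf 1^{\rm T}a}-\frac{D_i}{a_i-\mathbf 1^{\rm T}a}-\mu_c^*+N_{\Omega_i}(p_i^* ),\qquad \Omega_i=[\underline p_i,\overline p_i].$$ Define $b_i^*=D_i-p_i^*-a_i\mu_c^*$ for $i\in\mathcal N$. Then $(p^*,b^* )$ is a generalized Nash equilibrium of the energy sharing game.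
   Context: Data: $n\ge 2$, $\mathcal N=\{1,\dots,n\}$; for each $i\in\mathcal N$, real numbers $a_i<0$, $D_i$, $\underline p_i\le\overline p_i$, and a function $h_i:\mathbb R\to\mathbb R$. $a,b,p,D$ denote the vectors of the corresponding components, $\mathbf 1$ is the all-ones vector, and $b_{-i}$ is $b$ with the $i$-th component removed; $(b_i,b_{-i})$ denotes $b$. $N_{\Omega_i}(x)=\{v\in\mathbb R: v(y-x)\le 0\ \forall y\in\Omega_i\}$ is the normal cone of $\Omega_i$ at $x\in\Omega_i$. Energy sharing game: with $\mu_c(b)=-\frac{\mathbf 1^{\rm T}b}{\mathbf 1^{\rm T}a}$, prosumer $i$, given $b_{-i}$, minimizes $f_i(p_i,b)=h_i(p_i)+(a_i\mu_c(b)+b_i)\mu_c(b)$ over $(p_i,b_i)\in\mathbb R^2$ subject to $p_i+a_i\mu_c(b)+b_i=D_i$ and $\underline p_i\le p_i\le\overline p_i$. A pair $(p^*,b^* )$ is a generalized Nash equilibrium if for every $i$, $(p_i^*,b_i^* )$ minimizes $f_i(p_i,(b_i,b_{-i}^* ))$ over all $(p_i,b_i)$ satisfying these constraints with $b=(b_i,b_{-i}^* )$. *)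

theory Defs
  imports "HOL-Analysis.Analysis"
begin

text \<open>
  The prosumers are the elements of a finite index type \<open>'n\<close>; the number of prosumers is
  \<open>CARD('n)\<close>. Parameters of the game: \<open>a\<close>, \<open>D\<close>, the bounds \<open>pl\<close>, \<open>pu\<close> on the \<open>p $ i\<close>, and the
  functions \<open>h i\<close>.
\<close>

definition mu_c :: "real ^ 'n \<Rightarrow> real ^ 'n \<Rightarrow> real" where
  "mu_c a b = - (\<Sum>i\<in>UNIV. b $ i) / (\<Sum>i\<in>UNIV. a $ i)"

text \<open>\<open>upd b i \<beta>\<close> is the vector \<open>(\<beta>, b\<^sub>-\<^sub>i)\<close>.\<close>

definition upd :: "real ^ 'n \<Rightarrow> 'n \<Rightarrow> real \<Rightarrow> real ^ 'n" where
  "upd b i \<beta> = (\<chi> j. if j = i then \<beta> else b $ j)"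

definition prosumer_cost ::
    "real ^ 'n \<Rightarrow> ('n \<Rightarrow> real \<Rightarrow> real) \<Rightarrow> 'n \<Rightarrow> real \<Rightarrow> real ^ 'n \<Rightarrow> real" where
  "prosumer_cost a h i q b = h i q + (a $ i * mu_c a b + b $ i) * mu_c a b"

definition prosumer_feasible ::
    "real ^ 'n \<Rightarrow> real ^ 'n \<Rightarrow> real ^ 'n \<Rightarrow> real ^ 'n \<Rightarrow> 'n \<Rightarrow> real \<Rightarrow> real ^ 'n \<Rightarrow> bool" where
  "prosumer_feasible a D pl pu i q b \<longleftrightarrow>
     q + a $ i * mu_c a b + b $ i = D $ i \<and> pl $ i \<le> q \<and> q \<le> pu $ i"

definition game_feasible :: "real ^ 'n \<Rightarrow> real ^ 'n \<Rightarrow> real ^ 'n \<Rightarrow> real ^ 'n \<Rightarrow> bool" where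
  "game_feasible a D pl pu \<longleftrightarrow> (\<exists>p b. \<forall>i. prosumer_feasible a D pl pu i (p $ i) b)"

definition generalized_nash_equilibrium ::
    "real ^ 'n \<Rightarrow> real ^ 'n \<Rightarrow> real ^ 'n \<Rightarrow> real ^ 'n \<Rightarrow> ('n \<Rightarrow> real \<Rightarrow> real)
      \<Rightarrow> real ^ 'n \<Rightarrow> real ^ 'n \<Rightarrow> bool" where
  "generalized_nash_equilibrium a D pl pu h p b \<longleftrightarrow>
     (\<forall>i. is_arg_min (\<lambda>(q, \<beta>). prosumer_cost a h i q (upd b i \<beta>))
            (\<lambda>(q, \<beta>). prosumer_feasible a D pl pu i q (upd b i \<beta>))
            (p $ i, b $ i))"

definition central_objective ::
    "real ^ 'n \<Rightarrow> real ^ 'n \<Rightarrow> ('n \<Rightarrow> real \<Rightarrow> real) \<Rightarrow> real ^ 'n \<Rightarrow> real" where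
  "central_objective a D h p =
     (\<Sum>i\<in>UNIV. h i (p $ i) + (p $ i)\<^sup>2 / (2 * (a $ i - (\<Sum>j\<in>UNIV. a $ j)))
                - D $ i / (a $ i - (\<Sum>j\<in>UNIV. a $ j)) * p $ i)"

definition central_feasible :: "real ^ 'n \<Rightarrow> real ^ 'n \<Rightarrow> real ^ 'n \<Rightarrow> real ^ 'n \<Rightarrow> bool" where
  "central_feasible D pl pu p \<longleftrightarrow>
     (\<Sum>i\<in>UNIV. p $ i) = (\<Sum>i\<in>UNIV. D $ i) \<and> (\<forall>i. pl $ i \<le> p $ i \<and> p $ i \<le> pu $ i)"

definition normal_cone :: "real set \<Rightarrow> real \<Rightarrow> real set" where
  "normal_cone \<Omega> x = {v. \<forall>y\<in>\<Omega>. v * (y - x) \<le> 0}"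

text \<open>The image below is the Minkowski sum of a point and the normal cone.\<close>

definition lagrange_multiplier ::
    "real ^ 'n \<Rightarrow> real ^ 'n \<Rightarrow> real ^ 'n \<Rightarrow> real ^ 'n \<Rightarrow> ('n \<Rightarrow> real \<Rightarrow> real)
      \<Rightarrow> real ^ 'n \<Rightarrow> real \<Rightarrow> bool" where
  "lagrange_multiplier a D pl pu h p \<mu> \<longleftrightarrow>
     (\<Sum>i\<in>UNIV. p $ i) = (\<Sum>i\<in>UNIV. D $ i) \<and>
     (\<forall>i. 0 \<in> (\<lambda>v. deriv (h i) (p $ i) + p $ i / (a $ i - (\<Sum>j\<in>UNIV. a $ j))
                       - D $ i / (a $ i - (\<Sum>j\<in>UNIV. a $ j)) - \<mu> + v)
               ` normal_cone {pl $ i..pu $ i} (p $ i))"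

end

theory Submission
  imports Defs
begin

text \<open>
  Write \<open>A = \<Sum>\<^sub>j a\<^sub>j\<close> and \<open>c\<^sub>i = a\<^sub>i - A > 0\<close>. The bids \<open>b\<close> clear the market at the price \<open>\<mu>\<close>.
  If prosumer \<open>i\<close> alone deviates to production \<open>q\<close>, balance forces the price
  \<open>m = \<mu> - (q - p\<^sub>i) / c\<^sub>i\<close>, and the cost becomes \<open>h\<^sub>i(q) + (D\<^sub>i - q) m\<close>. Its change is
  \<open>h\<^sub>i(q) - h\<^sub>i(p\<^sub>i) + ((p\<^sub>i - D\<^sub>i) / c\<^sub>i - \<mu>) (q - p\<^sub>i) + (q - p\<^sub>i)\<^sup>2 / c\<^sub>i\<close>, which is nonnegative by
  the tangent inequality for \<open>h\<^sub>i\<close> and the stationarity condition of the central problem.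
\<close>

lemma sum_upd:
  fixes b :: "real ^ 'n"
  shows "(\<Sum>j\<in>UNIV. upd b i \<beta> $ j) = (\<Sum>j\<in>UNIV. b $ j) + (\<beta> - b $ i)"
proof -
  have "upd b i \<beta> $ j = b $ j + (if j = i then \<beta> - b $ i else 0)" for j
    by (simp add: upd_def)
  then show ?thesis
    by (simp add: sum.distrib)
qed

lemma upd_same [simp]: "upd b i \<beta> $ i = \<beta>"
  by (simp add: upd_def)

lemma upd_self [simp]: "upd b i (b $ i) = b"
  by (simp add: upd_def vec_eq_iff)

text \<open>With two or more prosumers, the sum of the remaining components is nonempty and strictly
  negative. This gives the positive denominators \<open>a $ i - S\<close> used below.\<close>

lemma sum_less_component:
  fixes a :: "real ^ 'n"
  assumes "CARD('n) \<ge> 2" and neg: "\<And>i. a $ i < 0"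
  shows "(\<Sum>j\<in>UNIV. a $ j) < a $ i"
proof -
  have "card (UNIV - {i}) > 0"
    using assms(1) by (simp add: card_Diff_singleton)
  then have "UNIV - {i} \<noteq> {}"
    by (metis card.empty less_irrefl)
  then have "(\<Sum>j\<in>UNIV - {i}. a $ j) < (\<Sum>j\<in>UNIV - {i}. 0)"
    using neg by (intro sum_strict_mono) auto
  then show ?thesis
    by (simp add: sum.remove[of UNIV i])
qed

text \<open>Summing the bids, total \<open>p\<close> cancels total \<open>D\<close>, leaving
  \<open>- \<mu>\<close> times the sum of \<open>a\<close>.\<close>

lemma mu_c_eq_multiplier:
  fixes a D p b :: "real ^ 'n"
  assumes "(\<Sum>j\<in>UNIV. a $ j) \<noteq> 0"
    and "(\<Sum>j\<in>UNIV. p $ j) = (\<Sum>j\<in>UNIV. D $ j)"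
    and "\<And>i. b $ i = D $ i - p $ i - a $ i * \<mu>"
  shows "mu_c a b = \<mu>"
  using assms by (simp add: mu_c_def sum_subtractf flip: sum_distrib_right)

text \<open>Clearing gives \<open>S\<close> times the price change as
  \<open>b $ i - \<beta>\<close>; subtracting the two balance equations then eliminates the
  bids.\<close>

lemma deviation_price:
  fixes a b :: "real ^ 'n"
  assumes A: "(\<Sum>j\<in>UNIV. a $ j) \<noteq> 0" "a $ i \<noteq> (\<Sum>j\<in>UNIV. a $ j)"
    and "q + a $ i * mu_c a (upd b i \<beta>) + \<beta> = d"
    and "r + a $ i * mu_c a b + b $ i = d"
  shows "mu_c a (upd b i \<beta>) = mu_c a b - (q - r) / (a $ i - (\<Sum>j\<in>UNIV. a $ j))"
proof -
  define S where "S = (\<Sum>j\<in>UNIV. a $ j)"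
  have "S * mu_c a (upd b i \<beta>) = S * mu_c a b - (\<beta> - b $ i)"
    using A(1) by (simp add: mu_c_def sum_upd S_def)
  then have "(a $ i - S) * (mu_c a b - mu_c a (upd b i \<beta>)) = q - r"
    using assms(3,4) by (simp add: algebra_simps)
  moreover have "a $ i - S \<noteq> 0"
    using A(2) by (simp add: S_def)
  ultimately show ?thesis
    unfolding S_def[symmetric] by (simp add: field_simps)
qed

lemma convex_deviation_cost:
  fixes f :: "real \<Rightarrow> real"
  assumes "convex_on UNIV f" "f differentiable (at r)" "c > 0"
    and stationary: "0 \<le> (deriv f r + (r - d) / c - m) * (q - r)"
  shows "f r + (d - r) * m \<le> f q + (d - q) * (m - (q - r) / c)"
proof -
  have "(f has_real_derivative deriv f r) (at r)"
    using assms(2) by (simp add: DERIV_deriv_iff_real_differentiable)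
  then have tangent: "deriv f r * (q - r) \<le> f q - f r"
    using convex_on_imp_above_tangent[OF assms(1), of r q] by simp
  \<comment> \<open>Exact expansion around \<open>r\<close>: the linear coefficient joins
    \<open>deriv f r\<close> in \<open>stationary\<close>, and the remainder is a square over
    \<open>c\<close>.\<close>
  have "(d - q) * (m - (q - r) / c) - (d - r) * m
      = ((r - d) / c - m) * (q - r) + (q - r)\<^sup>2 / c"
    using \<open>c > 0\<close> by (simp add: field_simps power2_eq_square)
  moreover have "(q - r)\<^sup>2 / c \<ge> 0"
    using \<open>c > 0\<close> by simp
  ultimately show ?thesis
    using tangent stationary by (simp add: algebra_simps)
qed

theorem mainTheorem2:
  fixes a D pl pu p b :: "real ^ 'n" and h :: "'n \<Rightarrow> real \<Rightarrow> real" and \<mu> :: real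
  assumes "CARD('n) \<ge> 2"
    and "\<And>i. a $ i < 0"
    and "\<And>i. pl $ i \<le> pu $ i"
    and "\<And>i. convex_on UNIV (h i)"
    and "\<And>i x. h i differentiable (at x)"
    and "game_feasible a D pl pu"
    and "is_arg_min (central_objective a D h) (central_feasible D pl pu) p"
    and "lagrange_multiplier a D pl pu h p \<mu>"
    and "\<And>i. b $ i = D $ i - p $ i - a $ i * \<mu>"
  shows "generalized_nash_equilibrium a D pl pu h p b"
proof -
  define S where "S = (\<Sum>j\<in>UNIV. a $ j)"
  have S_less: "S < a $ i" for i
    unfolding S_def using assms(1,2) by (rule sum_less_component)
  then have "S \<noteq> 0"
    using assms(2) by (metis less_asym)
  have price: "mu_c a b = \<mu>"
    using \<open>S \<noteq> 0\<close> assms(8,9) unfolding S_def lagrange_multiplier_def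
    by (intro mu_c_eq_multiplier) auto
  have bounds: "pl $ i \<le> p $ i" "p $ i \<le> pu $ i" for i
    using assms(7) by (auto simp: is_arg_min_def central_feasible_def)
  have balance: "p $ i + a $ i * mu_c a b + b $ i = D $ i" for i
    using assms(9) by (simp add: price)
  have best: "prosumer_cost a h i (p $ i) b \<le> prosumer_cost a h i q (upd b i \<beta>)"
    if feas: "prosumer_feasible a D pl pu i q (upd b i \<beta>)" for i q \<beta>
  proof -
    have dev: "q + a $ i * mu_c a (upd b i \<beta>) + \<beta> = D $ i" and q: "q \<in> {pl $ i..pu $ i}"
      using feas by (auto simp: prosumer_feasible_def)
    have price': "mu_c a (upd b i \<beta>) = \<mu> - (q - p $ i) / (a $ i - S)"
      using deviation_price[OF _ _ dev balance] \<open>S \<noteq> 0\<close> S_less[of i]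
      by (simp add: price S_def)
    \<comment> \<open>Stationarity makes the marginal cost \<open>- v\<close>; since
      \<open>q\<close> lies in the same interval, the normal cone fixes the sign of its product with
      \<open>q - p $ i\<close>.\<close>
    obtain v where v: "v \<in> normal_cone {pl $ i..pu $ i} (p $ i)"
      and "0 = deriv (h i) (p $ i) + p $ i / (a $ i - S) - D $ i / (a $ i - S) - \<mu> + v"
      using assms(8) unfolding lagrange_multiplier_def S_def by blast
    then have "deriv (h i) (p $ i) + (p $ i - D $ i) / (a $ i - S) - \<mu> = - v"
      by (simp add: diff_divide_distrib)
    moreover have "v * (q - p $ i) \<le> 0"
      using v q unfolding normal_cone_def by blast
    ultimately have "0 \<le> (deriv (h i) (p $ i) + (p $ i - D $ i) / (a $ i - S) - \<mu>) * (q - p $ i)"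
      by simp
    then have "h i (p $ i) + (D $ i - p $ i) * \<mu>
        \<le> h i q + (D $ i - q) * (\<mu> - (q - p $ i) / (a $ i - S))"
      using S_less[of i] assms(4,5) by (intro convex_deviation_cost) auto
    moreover have "a $ i * mu_c a b + b $ i = D $ i - p $ i"
      using balance[of i] by linarith
    moreover have "a $ i * mu_c a (upd b i \<beta>) + \<beta> = D $ i - q"
      using dev by linarith
    ultimately show ?thesis
      by (simp add: prosumer_cost_def price price')
  qed
  \<comment> \<open>At \<open>\<beta> = b $ i\<close> the updated bid vector is \<open>b\<close>
    itself, by \<open>upd_self\<close>.\<close>
  show ?thesis
    unfolding generalized_nash_equilibrium_def is_arg_min_def
    using bounds balance best by (auto simp: prosumer_feasible_def not_less)
qed

end
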